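(* For every odd integer $n \geq 1$, $\dim_E(CS_n) = \frac{3(n+1)}{2}$.
   Context: For a connected graph $G$, $d_G(u,v)$ is the number of edges in a shortest path between vertices $u$ and $v$. For a vertex $u$ and an edge $e = vw$, the distance is $d_G(e,u) = \min\{d_G(v,u), d_G(w,u)\}$. A set $S \subseteq V(G)$ is an edge resolving set of $G$ if for every pair of distinct edges $e,f \in E(G)$ there is $w \in S$ with $d_G(w,e) \neq d_G(w,f)$. The edge metric dimension $\dim_E(G)$ is the minimum cardinality of an edge resolving set of $G$. The chain silicate $CS_n$ consists of $n$ tetrahedra joined linearly (in a single row): it is the simple graph that is the union of $n$ complete graphs $R_1,\dots,R_n$, each isomorphic to $K_4$, such that for $1 \le i \le n-1$ the graphs $R_i$ and $R_{i+1}$ share exactly one vertex, these $n-1$ shared vertices are pairwise distinct, and $R_i, R_j$ share no vertex when $|i-j| \geq 2$. It has $3n+1$ vertices and $6n$ edges; in particular $CS_1 = K_4$. *)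

theory Defs
  imports Main
begin

text \<open>
  A finite simple graph is given by its vertex set \<open>V\<close> and its set \<open>E\<close> of edges, an edge being
  a two-element set of vertices.
\<close>

definition graph_path :: "'a set \<Rightarrow> 'a set set \<Rightarrow> 'a \<Rightarrow> 'a list \<Rightarrow> 'a \<Rightarrow> bool" where
  "graph_path V E u p v \<longleftrightarrow>
     p \<noteq> [] \<and> hd p = u \<and> last p = v \<and> set p \<subseteq> V \<and> distinct p \<and>
     (\<forall>i. Suc i < length p \<longrightarrow> {p ! i, p ! Suc i} \<in> E)"

text \<open>Only meaningful when some path joins \<open>u\<close> and \<open>v\<close>; otherwise the value is unspecified.\<close>

definition graph_dist :: "'a set \<Rightarrow> 'a set set \<Rightarrow> 'a \<Rightarrow> 'a \<Rightarrow> nat" where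
  "graph_dist V E u v = (LEAST k. \<exists>p. graph_path V E u p v \<and> length p = Suc k)"

definition edge_dist :: "'a set \<Rightarrow> 'a set set \<Rightarrow> 'a set \<Rightarrow> 'a \<Rightarrow> nat" where
  "edge_dist V E e u = Min ((\<lambda>v. graph_dist V E v u) ` e)"

definition edge_resolving :: "'a set \<Rightarrow> 'a set set \<Rightarrow> 'a set \<Rightarrow> bool" where
  "edge_resolving V E S \<longleftrightarrow>
     S \<subseteq> V \<and>
     (\<forall>e\<in>E. \<forall>f\<in>E. e \<noteq> f \<longrightarrow> (\<exists>w\<in>S. edge_dist V E e w \<noteq> edge_dist V E f w))"

definition edge_metric_dim :: "'a set \<Rightarrow> 'a set set \<Rightarrow> nat" where
  "edge_metric_dim V E = (LEAST k. \<exists>S. finite S \<and> edge_resolving V E S \<and> card S = k)"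

definition complete_edges :: "'a set \<Rightarrow> 'a set set" where
  "complete_edges A = {e. e \<subseteq> A \<and> card e = 2}"

text \<open>
  \<open>chain_silicate n V E\<close> says that \<open>(V, E)\<close> is a copy of \<open>CS\<^sub>n\<close>, a graph determined only
  up to isomorphism. \<open>R i\<close> is the vertex set of the \<open>i\<close>-th tetrahedron, and \<open>x i\<close> is the vertex
  shared by tetrahedra \<open>i\<close> and \<open>i + 1\<close>.
\<close>

definition chain_silicate :: "nat \<Rightarrow> 'a set \<Rightarrow> 'a set set \<Rightarrow> bool" where
  "chain_silicate n V E \<longleftrightarrow>
     (\<exists>R x.
        (\<forall>i\<in>{1..n}. card (R i) = 4) \<and>
        (\<forall>i\<in>{1..<n}. R i \<inter> R (Suc i) = {x i}) \<and>
        inj_on x {1..<n} \<and>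
        (\<forall>i\<in>{1..n}. \<forall>j\<in>{1..n}. i + 2 \<le> j \<longrightarrow> R i \<inter> R j = {}) \<and>
        V = (\<Union>i\<in>{1..n}. R i) \<and>
        E = (\<Union>i\<in>{1..n}. complete_edges (R i)))"

text \<open>Such graphs exist: take the numbers up to \<open>3 * n\<close>, with \<open>3 * i\<close> shared for \<open>0 < i < n\<close>.\<close>

lemma chain_silicate_exists:
  assumes "n \<ge> 1"
  shows "chain_silicate n {0..3 * n}
           (\<Union>i\<in>{1..n}. complete_edges {3 * (i - 1)..3 * i})"
proof -
  have "\<exists>i\<in>{1..n}. 3 * (i - 1) \<le> v \<and> v \<le> 3 * i" if "v \<le> 3 * n" for v
    using that assms
    by (intro bexI[of _ "if v = 0 then 1 else (v + 2) div 3"]) auto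
  then have V: "{0..3 * n} = (\<Union>i\<in>{1..n}. {3 * (i - 1)..3 * i})"
    by fastforce
  have "{3 * (i - 1)..3 * i} \<inter> {3 * (Suc i - 1)..3 * Suc i} = {3 * i}" for i :: nat
    by auto
  with V show ?thesis
    unfolding chain_silicate_def
    by (intro exI[of _ "\<lambda>i. {3 * (i - 1)..3 * i}"] exI[of _ "\<lambda>i. 3 * i"])
      (auto simp: inj_on_def)
qed

end

theory Submission
  imports Defs
begin

text \<open>
  Call a vertex of the chain a cut vertex if two tetrahedra share it. There are \<open>3 * n + 1\<close>
  vertices and \<open>n - 1\<close> cut vertices, hence \<open>2 * n + 2\<close> other ones, each of which lies in exactly
  one tetrahedron. The whole question reduces to which of these a resolving set may omit: a set
  \<open>S\<close> of vertices is edge resolving if and only if any two distinct non-cut vertices outside \<open>S\<close>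
  lie in disjoint tetrahedra (\<open>spread_if_resolving\<close>, \<open>resolving_if_spread\<close>).

  For necessity, let \<open>a\<close> and \<open>b\<close> be omitted and let their tetrahedra share a third vertex \<open>c\<close>.
  All neighbours of \<open>a\<close> lie in its only tetrahedron and so are equal or adjacent to \<open>c\<close>. Hence no
  landmark other than \<open>a\<close> is nearer to \<open>a\<close> than to \<open>c\<close>, and it sees the edge \<open>{c, a}\<close> at its
  distance from \<open>c\<close>. The same holds for \<open>{c, b}\<close>, so the two edges are not told apart.

  For sufficiency, a non-cut landmark \<open>w\<close> in the tetrahedron \<open>R k\<close> detects by the distances 0
  and 1 whether an edge contains \<open>w\<close> and whether it meets \<open>R k\<close>. At most one of the at least two
  non-cut vertices of a tetrahedron is omitted, so every tetrahedron contains such a landmark, and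
  unresolved edges meet the same tetrahedra and contain the same non-cut landmarks. Because a cut
  vertex of an edge shows in the tetrahedra that the edge meets, two such edges can only differ in
  omitted vertices, of which there are not enough close together. Larger distances never enter, so no formula for distances along the
  chain is required.

  The omitted non-cut vertices thus lie in different, pairwise non-consecutive tetrahedra. Of
  these there are at most \<open>(n + 1) div 2\<close>, attained by the tetrahedra with odd index, and the
  dimension is \<open>2 * n + 2 - (n + 1) div 2\<close>; for odd \<open>n\<close> this is the claimed value.
\<close>

section \<open>Paths and distances in connected graphs\<close>

definition graph_connected :: "'a set \<Rightarrow> 'a set set \<Rightarrow> bool" where
  "graph_connected V E \<longleftrightarrow> (\<forall>u\<in>V. \<forall>v\<in>V. \<exists>p. graph_path V E u p v)"

text \<open>
  Since paths must not repeat vertices, they cannot be prolonged or concatenated freely. Cutting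
  a path at a vertex already visited repairs this without making it longer.
\<close>

lemma graph_path_suffix:
  assumes "graph_path V E u p v" "y \<in> set p"
  obtains q where "graph_path V E y q v" "length q \<le> length p"
proof -
  obtain a b where p: "p = a @ y # b"
    using assms(2) by (meson split_list)
  have "{(y # b) ! i, (y # b) ! Suc i} \<in> E" if "Suc i < length (y # b)" for i
  proof -
    have "Suc (length a + i) < length p"
      using that p by simp
    then have "{p ! (length a + i), p ! Suc (length a + i)} \<in> E"
      using assms(1) by (simp add: graph_path_def)
    moreover have "p ! (length a + i) = (y # b) ! i"
      by (simp only: p nth_append_length_plus)
    moreover have "p ! Suc (length a + i) = (y # b) ! Suc i"
      by (simp only: p nth_append_length_plus flip: add_Suc_right)
    ultimately show ?thesis
      by simp
  qed
  then have "graph_path V E y (y # b) v"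
    using assms(1) p unfolding graph_path_def by auto
  then show ?thesis
    using that p by auto
qed

lemma graph_path_prepend:
  assumes "graph_path V E y q v" "u \<in> V" "u = y \<or> {u, y} \<in> E"
  obtains p where "graph_path V E u p v" "length p \<le> Suc (length q)"
proof (cases "u \<in> set q")
  case True
  then obtain p where "graph_path V E u p v" "length p \<le> length q"
    using graph_path_suffix[OF assms(1)] by blast
  then show ?thesis
    using that[of p] by simp
next
  case False
  have q: "q \<noteq> []" "hd q = y"
    using assms(1) by (auto simp: graph_path_def)
  then have "u \<noteq> y"
    using False by auto
  then have uy: "{u, q ! 0} \<in> E"
    using assms(3) q by (simp add: hd_conv_nth)
  have "{(u # q) ! i, (u # q) ! Suc i} \<in> E" if "Suc i < length (u # q)" for i
    using that assms(1) uy by (cases i) (auto simp: graph_path_def)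
  then have "graph_path V E u (u # q) v"
    using assms(1,2) False by (auto simp: graph_path_def)
  then show ?thesis
    using that by auto
qed

lemma graph_path_if_rtrancl:
  assumes "(u, v) \<in> {(a, b). a \<in> V \<and> b \<in> V \<and> {a, b} \<in> E}\<^sup>*" "v \<in> V"
  shows "\<exists>p. graph_path V E u p v"
  using assms(1)
proof (induction rule: converse_rtrancl_induct)
  case base
  have "graph_path V E v [v] v"
    using assms(2) by (simp add: graph_path_def)
  then show ?case ..
next
  case (step a b)
  then show ?case
    by (blast elim: graph_path_prepend)
qed

lemma graph_dist_le:
  assumes "graph_path V E u p v" "length p \<le> Suc k"
  shows "graph_dist V E u v \<le> k"
proof -
  have "length p = Suc (length p - 1)"
    using assms(1) by (cases p) (auto simp: graph_path_def)
  then have "graph_dist V E u v \<le> length p - 1"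
    unfolding graph_dist_def using assms(1) by (intro Least_le) blast
  then show ?thesis
    using assms(2) by simp
qed

lemma shortest_graph_path:
  assumes "graph_connected V E" "u \<in> V" "v \<in> V"
  obtains p where "graph_path V E u p v" "length p = Suc (graph_dist V E u v)"
proof -
  obtain p where p: "graph_path V E u p v"
    using assms unfolding graph_connected_def by blast
  then have "length p = Suc (length p - 1)"
    by (cases p) (auto simp: graph_path_def)
  then have "\<exists>k. \<exists>p. graph_path V E u p v \<and> length p = Suc k"
    using p by blast
  from LeastI_ex[OF this] show ?thesis
    using that unfolding graph_dist_def by blast
qed

lemma graph_dist_eq_0_iff:
  assumes "graph_connected V E" "u \<in> V" "v \<in> V"
  shows "graph_dist V E u v = 0 \<longleftrightarrow> u = v"
proof
  assume "graph_dist V E u v = 0"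
  then obtain p where "graph_path V E u p v" "length p = 1"
    using shortest_graph_path[OF assms] by auto
  then show "u = v"
    by (auto simp: graph_path_def length_Suc_conv)
next
  assume "u = v"
  then have "graph_path V E u [u] v"
    using assms by (simp add: graph_path_def)
  then show "graph_dist V E u v = 0"
    using graph_dist_le[of V E u "[u]" v 0] by simp
qed

lemma graph_dist_le_1_iff:
  assumes "graph_connected V E" "u \<in> V" "v \<in> V"
  shows "graph_dist V E u v \<le> 1 \<longleftrightarrow> u = v \<or> {u, v} \<in> E"
proof
  assume *: "graph_dist V E u v \<le> 1"
  obtain p where p: "graph_path V E u p v" "length p = Suc (graph_dist V E u v)"
    using shortest_graph_path[OF assms] .
  show "u = v \<or> {u, v} \<in> E"
  proof (cases "graph_dist V E u v = 0")
    case True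
    then show ?thesis
      using graph_dist_eq_0_iff[OF assms] by simp
  next
    case False
    then have "length p = Suc (Suc 0)"
      using * p by simp
    then obtain a b where "p = [a, b]"
      by (auto simp: length_Suc_conv)
    then show ?thesis
      using p(1) by (auto simp: graph_path_def)
  qed
next
  assume "u = v \<or> {u, v} \<in> E"
  moreover have "graph_path V E v [v] v"
    using assms by (simp add: graph_path_def)
  ultimately obtain p where "graph_path V E u p v" "length p \<le> Suc (length [v])"
    using graph_path_prepend assms(2) by metis
  then show "graph_dist V E u v \<le> 1"
    by (intro graph_dist_le) auto
qed

text \<open>
  A shortest path from \<open>a\<close> to \<open>w\<close> leaves \<open>a\<close> through a vertex that \<open>c\<close> dominates too, so it can
  be rerouted to start at \<open>c\<close>.
\<close>

lemma graph_dist_dominating: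
  assumes conn: "graph_connected V E" and "a \<in> V" "c \<in> V" "w \<in> V" "w \<noteq> a"
    and dom: "\<And>v. {a, v} \<in> E \<Longrightarrow> v = c \<or> {c, v} \<in> E"
  shows "graph_dist V E c w \<le> graph_dist V E a w"
proof -
  obtain p where p: "graph_path V E a p w" "length p = Suc (graph_dist V E a w)"
    using shortest_graph_path[OF conn \<open>a \<in> V\<close> \<open>w \<in> V\<close>] .
  then obtain v r where pr: "p = a # v # r"
    using \<open>w \<noteq> a\<close> unfolding graph_path_def by (cases p; cases "tl p") auto
  have "{p ! 0, p ! Suc 0} \<in> E"
    using p(1) pr unfolding graph_path_def by auto
  then have "c = v \<or> {c, v} \<in> E"
    using dom pr by auto
  moreover obtain q where "graph_path V E v q w" "length q < length p"
  proof -
    have "graph_path V E v (v # r) w"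
      using p(1) unfolding pr graph_path_def by fastforce
    then show ?thesis
      using that pr by auto
  qed
  ultimately obtain p' where "graph_path V E c p' w" "length p' \<le> Suc (length q)"
    using graph_path_prepend \<open>c \<in> V\<close> by metis
  with \<open>length q < length p\<close> p(2) show ?thesis
    by (intro graph_dist_le) auto
qed

lemma edge_dist_le_iff:
  assumes "finite e" "e \<noteq> {}"
  shows "edge_dist V E e w \<le> k \<longleftrightarrow> (\<exists>v\<in>e. graph_dist V E v w \<le> k)"
  unfolding edge_dist_def using assms by (simp add: Min_le_iff)

lemma edge_dist_doubleton:
  "edge_dist V E {a, b} w = min (graph_dist V E a w) (graph_dist V E b w)"
  unfolding edge_dist_def by simp

section \<open>Edge resolving sets of a chain of tetrahedra\<close>

text \<open>
  The locale fixes the tetrahedra and shared vertices whose existence makes a graph a chain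
  silicate.
\<close>

locale silicate_chain =
  fixes n :: nat and R :: "nat \<Rightarrow> 'a set" and x :: "nat \<Rightarrow> 'a" and V E
  assumes card_R: "i \<in> {1..n} \<Longrightarrow> card (R i) = 4"
    and consecutive: "i \<in> {1..<n} \<Longrightarrow> R i \<inter> R (Suc i) = {x i}"
    and inj_x: "inj_on x {1..<n}"
    and far: "\<lbrakk>i \<in> {1..n}; j \<in> {1..n}; i + 2 \<le> j\<rbrakk> \<Longrightarrow> R i \<inter> R j = {}"
    and V_eq: "V = (\<Union>i\<in>{1..n}. R i)"
    and E_eq: "E = (\<Union>i\<in>{1..n}. complete_edges (R i))"
begin

definition cut :: "'a set" where
  "cut = x ` {1..<n}"

definition noncut :: "'a set" where
  "noncut = V - cut"

lemma finite_R: "i \<in> {1..n} \<Longrightarrow> finite (R i)"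
  using card_R by (metis card.infinite zero_neq_numeral)

lemma in_V_iff: "v \<in> V \<longleftrightarrow> (\<exists>i\<in>{1..n}. v \<in> R i)"
  by (auto simp: V_eq)

lemma R_subset_V: "i \<in> {1..n} \<Longrightarrow> R i \<subseteq> V"
  using in_V_iff by blast

lemma finite_V: "finite V"
  using finite_R by (auto simp: V_eq)

lemma near_if_meet:
  assumes "i \<in> {1..n}" "j \<in> {1..n}" "R i \<inter> R j \<noteq> {}"
  shows "i \<le> Suc j" "j \<le> Suc i"
  using far[of i j] far[of j i] assms by (auto simp: Int_commute not_less_eq_eq[symmetric])

lemma meet_in_cut:
  assumes "i \<in> {1..n}" "j \<in> {1..n}" "i \<noteq> j" "c \<in> R i" "c \<in> R j"
  shows "c \<in> cut" "R i \<inter> R j = {c}"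
proof -
  have *: "c \<in> cut \<and> R k \<inter> R (Suc k) = {c}"
    if "k \<in> {1..<n}" "c \<in> R k" "c \<in> R (Suc k)" for k
    proof -
    have "c = x k"
      using consecutive[OF that(1)] that(2,3) by blast
    then show ?thesis
      using consecutive[OF that(1)] that(1) by (auto simp: cut_def)
  qed
  have "j = Suc i \<or> i = Suc j"
    using near_if_meet[of i j] assms by force
  then have "c \<in> cut \<and> R i \<inter> R j = {c}"
  proof
    assume "j = Suc i"
    then show ?thesis using *[of i] assms by simp
  next
    assume "i = Suc j"
    then show ?thesis using *[of j] assms by (simp add: Int_commute)
  qed
  then show "c \<in> cut" "R i \<inter> R j = {c}"
    by auto
qed

lemma index_unique:
  assumes "v \<in> noncut" "i \<in> {1..n}" "j \<in> {1..n}" "v \<in> R i" "v \<in> R j"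
  shows "i = j"
  using meet_in_cut(1)[of i j v] assms by (auto simp: noncut_def)

text \<open>
  A cut vertex of \<open>R i\<close> is the only vertex that \<open>R i\<close> shares with the neighbour on its side. For an
  edge inside \<open>R i\<close>, containing the cut vertex therefore means meeting that neighbour.
\<close>

lemma cut_neighbour:
  assumes "i \<in> {1..n}" "u \<in> R i" "u \<in> cut"
  obtains k where "k \<in> {1..n}" "k \<noteq> i" "R i \<inter> R k = {u}"
proof -
  obtain m where m: "m \<in> {1..<n}" "u = x m"
    using assms(3) by (auto simp: cut_def)
  then have u: "u \<in> R m" "u \<in> R (Suc m)"
    using consecutive by blast+
  define k where "k = (if m = i then Suc m else m)"
  have "k \<in> {1..n}" "k \<noteq> i" "u \<in> R k"
    using m u by (auto simp: k_def)
  then show ?thesis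
    using that meet_in_cut(2)[of i k u] assms by metis
qed

text \<open>
  For the end tetrahedra one of the two values is an arbitrary value of \<open>x\<close> outside its meaningful
  range, which does no harm to an upper bound.
\<close>

lemma cut_in_R:
  assumes "i \<in> {1..n}"
  shows "R i \<inter> cut \<subseteq> {x (i - 1), x i}"
proof
  fix u assume u: "u \<in> R i \<inter> cut"
  then obtain m where m: "m \<in> {1..<n}" "u = x m"
    by (auto simp: cut_def)
  then have "u \<in> R m" "u \<in> R (Suc m)"
    using consecutive by blast+
  then have "m = i \<or> Suc m = i"
    using near_if_meet[of i m] near_if_meet[of i "Suc m"] assms u m(1) by force
  then show "u \<in> {x (i - 1), x i}"
    using m by auto
qed

lemma two_noncut:
  assumes "i \<in> {1..n}"
  shows "2 \<le> card (R i \<inter> noncut)"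
proof -
  have "R i \<inter> noncut = R i - R i \<inter> cut"
    using R_subset_V[OF assms] by (auto simp: noncut_def)
  moreover have "card (R i \<inter> cut) \<le> 2"
    using card_mono[OF _ cut_in_R[OF assms]] by (simp add: card_insert_if split: if_splits)
  ultimately show ?thesis
    using card_R[OF assms] finite_R[OF assms] by (simp add: card_Diff_subset)
qed

lemma edge_iff: "{u, v} \<in> E \<longleftrightarrow> u \<noteq> v \<and> (\<exists>i\<in>{1..n}. u \<in> R i \<and> v \<in> R i)"
  by (auto simp: E_eq complete_edges_def card_insert_if)

lemma noncut_neighbour_iff:
  assumes "a \<in> noncut" "i \<in> {1..n}" "a \<in> R i"
  shows "{a, v} \<in> E \<longleftrightarrow> v \<noteq> a \<and> v \<in> R i"
proof
  assume "{a, v} \<in> E"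
  then obtain j where "j \<in> {1..n}" "a \<in> R j" "v \<in> R j" "v \<noteq> a"
    by (auto simp: edge_iff)
  then show "v \<noteq> a \<and> v \<in> R i"
    using index_unique[of a i j] assms by simp
next
  assume "v \<noteq> a \<and> v \<in> R i"
  then show "{a, v} \<in> E"
    using assms by (auto simp: edge_iff)
qed

lemma connected: "graph_connected V E"
proof -
  let ?A = "{(a, b). a \<in> V \<and> b \<in> V \<and> {a, b} \<in> E}"
  have adj: "(a, b) \<in> ?A\<^sup>*" if "i \<in> {1..n}" "a \<in> R i" "b \<in> R i" for i a b
  proof (cases "a = b")
    case False
    then have "(a, b) \<in> ?A"
      using that by (auto simp: in_V_iff edge_iff)
    then show ?thesis ..
  qed simp
  have sym: "(b, a) \<in> ?A\<^sup>*" if "(a, b) \<in> ?A\<^sup>*" for a b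
  proof -
    have "sym ?A"
      by (auto simp: sym_def insert_commute)
    then show ?thesis
      using that by (meson sym_rtrancl symD)
  qed
  have forward: "(a, b) \<in> ?A\<^sup>*"
    if "1 \<le> i" "i \<le> j" "j \<le> n" "a \<in> R i" "b \<in> R j" for i j a b
    using that(2,1,3,4,5)
  proof (induction arbitrary: b rule: dec_induct)
    case base
    then show ?case using adj by auto
  next
    case (step m)
    then have "x m \<in> R m" "x m \<in> R (Suc m)"
      using consecutive[of m] by auto
    then have "(a, x m) \<in> ?A\<^sup>*" "(x m, b) \<in> ?A\<^sup>*"
      using step adj[of "Suc m"] by auto
    then show ?case by simp
  qed
  have "(a, b) \<in> ?A\<^sup>*" if "a \<in> V" "b \<in> V" for a b
  proof -
    obtain i j where "i \<in> {1..n}" "a \<in> R i" "j \<in> {1..n}" "b \<in> R j"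
      using \<open>a \<in> V\<close> \<open>b \<in> V\<close> by (auto simp: in_V_iff)
    then show ?thesis
      using forward[of i j a b] sym[OF forward[of j i b a]] by (cases "i \<le> j") auto
  qed
  then show ?thesis
    unfolding graph_connected_def by (intro ballI graph_path_if_rtrancl)
qed

lemma edge_cases:
  assumes "e \<in> E"
  obtains i where "i \<in> {1..n}" "e \<subseteq> R i" "card e = 2" "finite e" "e \<noteq> {}" "e \<subseteq> V"
proof -
  obtain i where i: "i \<in> {1..n}" "e \<subseteq> R i" "card e = 2"
    using assms by (auto simp: E_eq complete_edges_def)
  moreover have "finite e" "e \<noteq> {}"
    using i(3) by (auto intro: card_ge_0_finite)
  moreover have "e \<subseteq> V"
    using i R_subset_V by blast
  ultimately show ?thesis
    using that by blast
qed

lemma edge_dist_noncut_eq_0_iff: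
  assumes "e \<in> E" "w \<in> noncut"
  shows "edge_dist V E e w = 0 \<longleftrightarrow> w \<in> e"
proof -
  obtain i where e: "finite e" "e \<noteq> {}" "e \<subseteq> V"
    using assms(1) by (rule edge_cases)
  have "edge_dist V E e w \<le> 0 \<longleftrightarrow> w \<in> e"
    unfolding edge_dist_le_iff[OF e(1,2)]
    using graph_dist_eq_0_iff[OF connected] e(3) assms(2) by (auto simp: noncut_def)
  then show ?thesis
    by simp
qed

lemma edge_dist_noncut_le_1_iff:
  assumes "e \<in> E" "w \<in> noncut" "k \<in> {1..n}" "w \<in> R k"
  shows "edge_dist V E e w \<le> 1 \<longleftrightarrow> e \<inter> R k \<noteq> {}"
proof -
  obtain i where e: "finite e" "e \<noteq> {}" "e \<subseteq> V"
    using assms(1) by (rule edge_cases)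
  have "graph_dist V E v w \<le> 1 \<longleftrightarrow> v \<in> R k" if "v \<in> e" for v
  proof -
    have "graph_dist V E v w \<le> 1 \<longleftrightarrow> v = w \<or> {w, v} \<in> E"
      using graph_dist_le_1_iff[OF connected, of v w] e(3) assms(2) that
      by (auto simp: noncut_def insert_commute)
    then show ?thesis
      using noncut_neighbour_iff[OF assms(2-4), of v] assms(4) by auto
  qed
  then show ?thesis
    unfolding edge_dist_le_iff[OF e(1,2)] by auto
qed

text \<open>
  In particular, by \<open>i = j\<close>, a tetrahedron contains at most one vertex of a spread set.
\<close>

definition spread :: "'a set \<Rightarrow> bool" where
  "spread M \<longleftrightarrow> (\<forall>a\<in>M. \<forall>b\<in>M. \<forall>i\<in>{1..n}. \<forall>j\<in>{1..n}.
     a \<noteq> b \<and> a \<in> R i \<and> b \<in> R j \<longrightarrow> R i \<inter> R j = {})"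

text \<open>
  Two omitted vertices whose tetrahedra share a third vertex \<open>c\<close> make \<open>{c, a}\<close> and \<open>{c, b}\<close>
  indistinguishable, because \<open>c\<close> dominates both \<open>a\<close> and \<open>b\<close>.
\<close>

lemma spread_if_resolving:
  assumes res: "edge_resolving V E S"
  shows "spread (noncut - S)"
  unfolding spread_def
proof (intro ballI impI)
  fix a b i j
  assume a: "a \<in> noncut - S" and b: "b \<in> noncut - S"
    and i: "i \<in> {1..n}" and j: "j \<in> {1..n}"
    and *: "a \<noteq> b \<and> a \<in> R i \<and> b \<in> R j"
  show "R i \<inter> R j = {}"
  proof (rule ccontr)
    assume meet: "R i \<inter> R j \<noteq> {}"
    \<comment> \<open>Inside one tetrahedron any third vertex serves; otherwise only the shared cut vertex does.\<close>
    obtain c where c: "c \<in> R i" "c \<in> R j" "c \<noteq> a" "c \<noteq> b"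
    proof (cases "i = j")
      case True
      have "card (R i - {a, b}) > 0"
        using card_R[OF i] finite_R[OF i] * True by (simp add: card_Diff_subset)
      then obtain c where "c \<in> R i - {a, b}"
        by (auto simp: card_gt_0_iff)
      then show ?thesis using that True by auto
    next
      case False
      obtain c where c: "c \<in> R i" "c \<in> R j"
        using meet by auto
      then have "c \<in> cut"
        using meet_in_cut i j False by blast
      then show ?thesis
        using that c a b by (auto simp: noncut_def)
    qed
    have V: "a \<in> V" "b \<in> V" "c \<in> V"
      using i j c * by (auto simp: in_V_iff)
    have c_nearer: "graph_dist V E c w \<le> graph_dist V E d w"
      if "w \<in> S" "d \<in> noncut - S" "k \<in> {1..n}" "d \<in> R k" "c \<in> R k" for w d k
    proof (rule graph_dist_dominating[OF connected])
      show "d \<in> V" "c \<in> V" "w \<in> V" "w \<noteq> d"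
        using that V res by (auto simp: noncut_def edge_resolving_def)
      show "v = c \<or> {c, v} \<in> E" if "{d, v} \<in> E" for v
        using that \<open>d \<in> noncut - S\<close> \<open>k \<in> {1..n}\<close> \<open>d \<in> R k\<close> \<open>c \<in> R k\<close>
          noncut_neighbour_iff[of d k v]
        by (auto simp: edge_iff)
    qed
    have "edge_dist V E {c, a} w = edge_dist V E {c, b} w" if "w \<in> S" for w
      using c_nearer[OF that a i] c_nearer[OF that b j] c *
      by (simp add: edge_dist_doubleton min_absorb1)
    moreover have "{c, a} \<in> E" "{c, b} \<in> E"
      using c i j * by (auto simp: edge_iff)
    moreover have "{c, a} \<noteq> {c, b}"
      using * c by (auto simp: doubleton_eq_iff)
    ultimately show False
      using res unfolding edge_resolving_def by metis
  qed
qed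

text \<open>
  Let two edges have equal distances to all landmarks. If they lie in one tetrahedron, they have
  the same cut vertices, hence differ in two non-cut vertices of it, both omitted. If they lie in
  different ones, both contain the shared vertex \<open>c\<close>, and their other ends \<open>y\<close> and \<open>z\<close> are not cut
  vertices, as otherwise the edges would meet different tetrahedra. So \<open>y\<close> and \<open>z\<close> are omitted,
  although their tetrahedra meet.
\<close>

lemma resolving_if_spread:
  assumes "S \<subseteq> V" and spread: "spread (noncut - S)"
  shows "edge_resolving V E S"
  unfolding edge_resolving_def
proof (intro conjI ballI impI, fact)
  fix e f assume e: "e \<in> E" and f: "f \<in> E" and "e \<noteq> f"
  show "\<exists>w\<in>S. edge_dist V E e w \<noteq> edge_dist V E f w"
  proof (rule ccontr)
    assume "\<not> ?thesis"
    then have same: "edge_dist V E e w = edge_dist V E f w" if "w \<in> S" for w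
      using that by blast
    have S_iff: "w \<in> e \<longleftrightarrow> w \<in> f" if "w \<in> S" "w \<in> noncut" for w
      using edge_dist_noncut_eq_0_iff[OF e that(2)] edge_dist_noncut_eq_0_iff[OF f that(2)]
        same[OF that(1)] by simp
    have meet_iff: "e \<inter> R k \<noteq> {} \<longleftrightarrow> f \<inter> R k \<noteq> {}" if k: "k \<in> {1..n}" for k
    proof -
      obtain w where w: "w \<in> R k" "w \<in> noncut" "w \<in> S"
      proof -
        obtain u v where "u \<in> R k \<inter> noncut" "v \<in> R k \<inter> noncut" "u \<noteq> v"
          using two_noncut[OF k] by (auto simp: card_le_Suc_iff numeral_2_eq_2)
        then have "u \<in> S \<or> v \<in> S"
          using spread k unfolding spread_def by blast
        then show ?thesis
          using that \<open>u \<in> R k \<inter> noncut\<close> \<open>v \<in> R k \<inter> noncut\<close> by blast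
      qed
      show ?thesis
        using edge_dist_noncut_le_1_iff[OF e w(2) k w(1)]
          edge_dist_noncut_le_1_iff[OF f w(2) k w(1)] same[OF w(3)] by simp
    qed
    obtain i where i: "i \<in> {1..n}" "e \<subseteq> R i" "card e = 2" "finite e" "e \<noteq> {}" "e \<subseteq> V"
      using e by (rule edge_cases)
    obtain j where j: "j \<in> {1..n}" "f \<subseteq> R j" "card f = 2" "finite f" "f \<noteq> {}" "f \<subseteq> V"
      using f by (rule edge_cases)
    show False
    proof (cases "i = j")
      case True
      have cut_iff: "u \<in> e \<longleftrightarrow> u \<in> f" if u: "u \<in> cut" "u \<in> R i" for u
      proof -
        obtain k where "k \<in> {1..n}" "R i \<inter> R k = {u}"
          using cut_neighbour[OF i(1) u(2,1)] .
        then show ?thesis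
          using meet_iff[of k] i(2) j(2) True by auto
      qed
      have "\<not> e \<subseteq> f" "\<not> f \<subseteq> e"
        using \<open>e \<noteq> f\<close> i(3,4) j(3,4) card_subset_eq by metis+
      then obtain u v where "u \<in> e - f" "v \<in> f - e"
        by blast
      then have uv: "u \<in> e" "u \<notin> f" "v \<in> f" "v \<notin> e" "u \<noteq> v" "u \<in> R i" "v \<in> R i"
        using i(2) j(2) True by auto
      then have "u \<in> noncut" "v \<in> noncut"
        using cut_iff i(6) j(6) by (auto simp: noncut_def)
      then have "u \<in> noncut - S" "v \<in> noncut - S"
        using S_iff uv by auto
      then show False
        using spread i(1) uv unfolding spread_def by blast
    next
      case False
      obtain c where "c \<in> e" "c \<in> R j"
        using meet_iff[OF j(1)] j(2,5) by blast
      have Rc: "R i \<inter> R j = {c}"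
        using meet_in_cut(2)[OF i(1) j(1) False] \<open>c \<in> e\<close> \<open>c \<in> R j\<close> i(2) by blast
      then have "c \<in> f"
      proof -
        obtain d where "d \<in> f" "d \<in> R i"
          using meet_iff[OF i(1)] i(2,5) by blast
        moreover from this have "d \<in> R i \<inter> R j"
          using j(2) by blast
        ultimately show ?thesis
          using Rc by simp
      qed
      \<comment> \<open>Three different indices cannot be pairwise consecutive.\<close>
      have no_third: "R i \<inter> R k = {} \<or> R j \<inter> R k = {}"
        if "k \<in> {1..n}" "k \<noteq> i" "k \<noteq> j" for k
        using near_if_meet[OF i(1) j(1)] near_if_meet[OF i(1) that(1)]
          near_if_meet[OF j(1) that(1)] Rc False that(2,3) by (cases "i < j") force+
      obtain y z where y: "y \<in> e" "y \<noteq> c" and z: "z \<in> f" "z \<noteq> c"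
        using i(3) j(3) by (metis card_2_iff insertCI)
      have "y \<notin> cut"
      proof
        assume "y \<in> cut"
        then obtain k where k: "k \<in> {1..n}" "k \<noteq> i" "R i \<inter> R k = {y}"
          using cut_neighbour[OF i(1)] y i(2) by blast
        then have "k \<noteq> j"
          using Rc y by auto
        moreover have "R j \<inter> R k \<noteq> {}"
          using meet_iff[OF k(1)] k(3) y j(2) by blast
        ultimately show False
          using no_third[OF k(1,2)] k(3) by blast
      qed
      moreover have "z \<notin> cut"
      proof
        assume "z \<in> cut"
        then obtain k where k: "k \<in> {1..n}" "k \<noteq> j" "R j \<inter> R k = {z}"
          using cut_neighbour[OF j(1)] z j(2) by blast
        then have "k \<noteq> i"
          using Rc z by auto
        moreover have "R i \<inter> R k \<noteq> {}"
          using meet_iff[OF k(1)] k(3) z i(2) j(2) by blast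
        ultimately show False
          using no_third[OF k(1)] k(2,3) by blast
      qed
      moreover have "y \<notin> f" "z \<notin> e"
        using Rc y z i(2) j(2) by blast+
      ultimately have "y \<in> noncut - S" "z \<in> noncut - S" "y \<noteq> z"
        using S_iff y z i(6) j(6) by (auto simp: noncut_def)
      then show False
        using spread i(1,2) j(1,2) y(1) z(1) Rc unfolding spread_def by blast
    qed
  qed
qed

section \<open>Counting\<close>

lemma card_noncut:
  assumes "n \<ge> 1"
  shows "card noncut = 2 * n + 2"
proof -
  have "card (\<Union>i\<in>{1..m}. R i) = 3 * m + 1" if "1 \<le> m" "m \<le> n" for m
    using that
  proof (induction rule: dec_induct)
    case base
    then show ?case using card_R[of 1] by simp
  next
    case (step m)
    let ?U = "\<Union>i\<in>{1..m}. R i"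
    have "?U \<inter> R (Suc m) = {x m}"
    proof -
      have "R i \<inter> R (Suc m) = {}" if "i \<in> {1..m}" "i \<noteq> m" for i
        using far[of i "Suc m"] that step by auto
      then show ?thesis
        using consecutive[of m] step by fastforce
    qed
    moreover have "finite ?U" "finite (R (Suc m))"
      using finite_R step by auto
    moreover have "(\<Union>i\<in>{1..Suc m}. R i) = ?U \<union> R (Suc m)"
      using step by (auto simp: atLeastAtMostSuc_conv)
    ultimately show ?case
      using card_Un_Int[of ?U "R (Suc m)"] step card_R[of "Suc m"] by simp
  qed
  then have "card V = 3 * n + 1"
    using assms by (simp add: V_eq)
  moreover have "cut \<subseteq> V"
    using consecutive by (fastforce simp: cut_def V_eq)
  moreover have "card cut = n - 1"
    using inj_x by (simp add: cut_def card_image)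
  ultimately show ?thesis
    using assms finite_V by (simp add: noncut_def card_Diff_subset finite_subset)
qed

text \<open>
  Grouping the tetrahedra as \<open>{1, 2}, {3, 4}, \<dots>\<close> gives \<open>(n + 1) div 2\<close> groups (the last one a
  singleton if \<open>n\<close> is odd). Tetrahedra of one group meet, so a spread set has at most one vertex in
  each group.
\<close>

lemma card_spread_le:
  assumes "M \<subseteq> noncut" "spread M"
  shows "card M \<le> (n + 1) div 2"
proof -
  have "\<exists>i. i \<in> {1..n} \<and> a \<in> R i" if "a \<in> M" for a
    proof -
    have "a \<in> V"
      using that assms(1) by (auto simp: noncut_def)
    then show ?thesis
      unfolding in_V_iff by blast
  qed
  then obtain t where t: "t a \<in> {1..n}" "a \<in> R (t a)" if "a \<in> M" for a
    by metis
  have "inj_on (\<lambda>a. (t a + 1) div 2) M"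
  proof (rule inj_onI, rule ccontr)
    fix a b
    assume ab: "a \<in> M" "b \<in> M" "(t a + 1) div 2 = (t b + 1) div 2" "a \<noteq> b"
    have disj: "R (t a) \<inter> R (t b) = {}"
      using assms(2) ab t unfolding spread_def by blast
    have "t a = t b \<or> t b = Suc (t a) \<or> t a = Suc (t b)"
      using ab(3) by presburger
    then show False
    proof (elim disjE)
      assume "t a = t b"
      then show False using disj t[OF ab(1)] by auto
    next
      assume "t b = Suc (t a)"
      then show False using disj t[OF ab(1)] t[OF ab(2)] consecutive[of "t a"] by auto
    next
      assume "t a = Suc (t b)"
      then show False using disj t[OF ab(1)] t[OF ab(2)] consecutive[of "t b"] by auto
    qed
  qed
  moreover have "(\<lambda>a. (t a + 1) div 2) ` M \<subseteq> {1..(n + 1) div 2}"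
    using t by (force intro: div_le_mono)
  ultimately have "card M \<le> card {1..(n + 1) div 2}"
    by (intro card_inj_on_le) auto
  then show ?thesis
    by simp
qed

lemma spread_witness:
  obtains M where "M \<subseteq> noncut" "spread M" "card M = (n + 1) div 2"
proof -
  have "\<exists>q. q \<in> R i \<inter> noncut" if "i \<in> {1..n}" for i
    using two_noncut[OF that] by (cases "R i \<inter> noncut = {}") auto
  then obtain q where q: "q i \<in> R i" "q i \<in> noncut" if "i \<in> {1..n}" for i
    by (metis IntD1 IntD2)
  define odds where "odds = (\<lambda>m. 2 * m + 1) ` {..<(n + 1) div 2}"
  have odds: "odds \<subseteq> {1..n}" "\<And>i. i \<in> odds \<Longrightarrow> odd i"
    by (auto simp: odds_def)
  have index: "j = i" if "i \<in> odds" "j \<in> {1..n}" "q i \<in> R j" for i j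
    using index_unique[of "q i" j i] q[of i] that odds(1) by blast
  have "inj_on q odds"
    using index q(1) odds(1) by (metis inj_onI subsetD)
  then have "card (q ` odds) = (n + 1) div 2"
    by (simp add: card_image odds_def inj_on_def)
  moreover have "spread (q ` odds)"
    unfolding spread_def
  proof (intro ballI impI)
    fix a b i j
    assume "a \<in> q ` odds" "b \<in> q ` odds" and ij: "i \<in> {1..n}" "j \<in> {1..n}"
      and *: "a \<noteq> b \<and> a \<in> R i \<and> b \<in> R j"
    then have "a = q i" "b = q j" "i \<in> odds" "j \<in> odds"
      using index by blast+
    moreover have "i \<noteq> j"
      using * \<open>a = q i\<close> \<open>b = q j\<close> by auto
    ultimately have "\<not> (i \<le> Suc j \<and> j \<le> Suc i)"
      using odds(2)[of i] odds(2)[of j] by presburger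
    then show "R i \<inter> R j = {}"
      using near_if_meet[OF ij] by blast
  qed
  ultimately show ?thesis
    using that[of "q ` odds"] q(2) odds(1) by blast
qed

text \<open>
  The characterisation of resolving sets and the maximal size of a spread set determine the
  dimension for either parity of \<open>n\<close>.
\<close>

lemma edge_metric_dim_silicate_chain:
  assumes "n \<ge> 1"
  shows "edge_metric_dim V E = 2 * n + 2 - (n + 1) div 2"
  unfolding edge_metric_dim_def
proof (rule Least_equality)
  have fin: "finite noncut"
    using finite_V by (simp add: noncut_def)
  obtain M where M: "M \<subseteq> noncut" "spread M" "card M = (n + 1) div 2"
    using spread_witness .
  have "noncut - (noncut - M) = M"
    using M(1) by auto
  then have "edge_resolving V E (noncut - M)"
    using M(2) by (intro resolving_if_spread) (auto simp: noncut_def)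
  moreover have "card (noncut - M) = 2 * n + 2 - (n + 1) div 2"
    using M fin card_noncut[OF assms] by (simp add: card_Diff_subset finite_subset)
  ultimately show "\<exists>S. finite S \<and> edge_resolving V E S \<and> card S = 2 * n + 2 - (n + 1) div 2"
    using fin by blast
next
  fix k assume "\<exists>S. finite S \<and> edge_resolving V E S \<and> card S = k"
  then obtain S where S: "finite S" "edge_resolving V E S" "card S = k"
    by blast
  have "card noncut - card S \<le> card (noncut - S)"
    using S(1) by (rule diff_card_le_card_Diff)
  also have "\<dots> \<le> (n + 1) div 2"
    using card_spread_le[OF _ spread_if_resolving[OF S(2)]] by blast
  finally show "2 * n + 2 - (n + 1) div 2 \<le> k"
    using S(3) card_noncut[OF assms] by linarith
qed

end

theorem theorem2:
  fixes n :: nat and V :: "'a set" and E :: "'a set set"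
  assumes "n \<ge> 1" and "odd n"
    and "chain_silicate n V E"
  shows "edge_metric_dim V E = 3 * (n + 1) div 2"
proof -
  obtain R x where "silicate_chain n R x V E"
    using assms(3) unfolding chain_silicate_def silicate_chain_def by metis
  then have "edge_metric_dim V E = 2 * n + 2 - (n + 1) div 2"
    using assms(1) by (rule silicate_chain.edge_metric_dim_silicate_chain)
  also have "\<dots> = 3 * (n + 1) div 2"
    using assms(2) by (elim oddE) simp
  finally show ?thesis .
qed

end
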